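(* Let $(\mathcal{V},g)$ be a finite-dimensional real vector space with a positive definite scalar product, and let $R$ be an algebraic curvature tensor on $(\mathcal{V},g)$. If $R$ is Clifford, then $R$ is Jacobi-orthogonal.
   Context: An algebraic curvature tensor on $(\mathcal{V},g)$ is a 4-linear form $R\colon\mathcal{V}^4\to\mathbb{R}$ satisfying $R(X,Y,Z,W)=-R(Y,X,Z,W)=-R(X,Y,W,Z)=R(Z,W,X,Y)$ and the first Bianchi identity $R(X,Y,Z,W)+R(Y,Z,X,W)+R(Z,X,Y,W)=0$ for all $X,Y,Z,W\in\mathcal{V}$. The associated curvature operator $\mathcal{R}$ is defined by $g(\mathcal{R}(X,Y)Z,W)=R(X,Y,Z,W)$. For $X\in\mathcal{V}$, the Jacobi operator is the self-adjoint linear operator $\mathcal{J}_X\colon\mathcal{V}\to\mathcal{V}$, $\mathcal{J}_XY=\mathcal{R}(Y,X)X$. A Clifford family of rank $m$ is a family $J_1,\dots,J_m$ of skew-adjoint (with respect to $g$) linear endomorphisms of $\mathcal{V}$ satisfying the Hurwitz relations $J_iJ_j+J_jJ_i=-2\delta_{ij}\,\mathrm{Id}$ for $1\le i,j\le m$ (for $m=0$ the family is empty). Any skew-adjoint endomorphism $J$ of $\mathcal{V}$ generates the algebraic curvature tensor $R^J(X,Y,Z,W)=g(JX,Z)g(JY,W)-g(JY,Z)g(JX,W)+2g(JX,Y)g(JZ,W)$, and $R^1$ is the algebraic curvature tensor of constant sectional curvature $1$, i.e. $R^1(X,Y,Z,W)=g(Y,Z)g(X,W)-g(X,Z)g(Y,W)$.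 $R$ is Clifford if there exist a Clifford family $J_1,\dots,J_m$ on $\mathcal{V}$ and $\mu_0,\dots,\mu_m\in\mathbb{R}$ such that $R=\mu_0R^1+\sum_{i=1}^m\mu_iR^{J_i}$. $R$ is Jacobi-orthogonal if $g(\mathcal{J}_XY,\mathcal{J}_YX)=0$ for all $X,Y\in\mathcal{V}$ with $g(X,Y)=0$. *)

theory Defs
  imports "HOL-Analysis.Analysis"
begin

text \<open>The pair \<open>(V, g)\<close> is a type \<open>'a :: real_inner\<close> with \<open>g = (\<bullet>)\<close>, together with
  the following hypothesis.  Unlike the class of Euclidean spaces, this allows the zero space.\<close>

definition finite_dim :: "'a::real_vector itself \<Rightarrow> bool" where
  "finite_dim _ \<longleftrightarrow> (\<exists>B::'a set. finite B \<and> span B = UNIV)"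

type_synonym 'a form4 = "'a \<Rightarrow> 'a \<Rightarrow> 'a \<Rightarrow> 'a \<Rightarrow> real"

definition four_linear :: "'a::real_vector form4 \<Rightarrow> bool" where
  "four_linear R \<longleftrightarrow>
     (\<forall>Y Z W. linear (\<lambda>X. R X Y Z W)) \<and> (\<forall>X Z W. linear (\<lambda>Y. R X Y Z W)) \<and>
     (\<forall>X Y W. linear (\<lambda>Z. R X Y Z W)) \<and> (\<forall>X Y Z. linear (\<lambda>W. R X Y Z W))"

definition algebraic_curvature_tensor :: "'a::real_vector form4 \<Rightarrow> bool" where
  "algebraic_curvature_tensor R \<longleftrightarrow> four_linear R \<and>
     (\<forall>X Y Z W. R X Y Z W = - R Y X Z W \<and> R X Y Z W = - R X Y W Z \<and> R X Y Z W = R Z W X Y) \<and>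
     (\<forall>X Y Z W. R X Y Z W + R Y Z X W + R Z X Y W = 0)"

text \<open>The description is proper on finite-dimensional spaces; see
  \<open>inner_curvature_operator\<close> below.\<close>

definition curvature_operator :: "'a::real_inner form4 \<Rightarrow> 'a \<Rightarrow> 'a \<Rightarrow> 'a \<Rightarrow> 'a" where
  "curvature_operator R X Y Z = (THE V. \<forall>W. V \<bullet> W = R X Y Z W)"

definition jacobi_operator :: "'a::real_inner form4 \<Rightarrow> 'a \<Rightarrow> 'a \<Rightarrow> 'a" where
  "jacobi_operator R X Y = curvature_operator R Y X X"

definition jacobi_orthogonal :: "'a::real_inner form4 \<Rightarrow> bool" where
  "jacobi_orthogonal R \<longleftrightarrow>
     (\<forall>X Y. X \<bullet> Y = 0 \<longrightarrow> jacobi_operator R X Y \<bullet> jacobi_operator R Y X = 0)"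

definition skew_adjoint :: "('a::real_inner \<Rightarrow> 'a) \<Rightarrow> bool" where
  "skew_adjoint J \<longleftrightarrow> linear J \<and> (\<forall>X Y. J X \<bullet> Y = - (X \<bullet> J Y))"

definition clifford_family :: "nat \<Rightarrow> (nat \<Rightarrow> 'a::real_inner \<Rightarrow> 'a) \<Rightarrow> bool" where
  "clifford_family m J \<longleftrightarrow>
     (\<forall>i\<in>{1..m}. skew_adjoint (J i)) \<and>
     (\<forall>i\<in>{1..m}. \<forall>j\<in>{1..m}. \<forall>X.
        J i (J j X) + J j (J i X) = (- 2 * (if i = j then 1 else 0)) *\<^sub>R X)"

definition curvature_one :: "'a::real_inner form4" where
  "curvature_one X Y Z W = (Y \<bullet> Z) * (X \<bullet> W) - (X \<bullet> Z) * (Y \<bullet> W)"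

definition curvature_of :: "('a::real_inner \<Rightarrow> 'a) \<Rightarrow> 'a form4" where
  "curvature_of J X Y Z W =
     (J X \<bullet> Z) * (J Y \<bullet> W) - (J Y \<bullet> Z) * (J X \<bullet> W) + 2 * (J X \<bullet> Y) * (J Z \<bullet> W)"

definition clifford :: "'a::real_inner form4 \<Rightarrow> bool" where
  "clifford R \<longleftrightarrow>
     (\<exists>(m::nat) (J :: nat \<Rightarrow> 'a \<Rightarrow> 'a) (\<mu> :: nat \<Rightarrow> real). clifford_family m J \<and>
        (\<forall>X Y Z W. R X Y Z W =
           \<mu> 0 * curvature_one X Y Z W + (\<Sum>i = 1..m. \<mu> i * curvature_of (J i) X Y Z W)))"

lemma finite_dim_riesz:
  fixes f :: "'a::real_inner \<Rightarrow> real"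
  assumes "finite_dim TYPE('a)" and f: "linear f"
  shows "\<exists>!V. \<forall>W. V \<bullet> W = f W"
proof -
  obtain B :: "'a set" where B: "finite B" "span B = UNIV"
    using assms(1) unfolding finite_dim_def by blast
  have ex: "\<exists>V \<in> span C. \<forall>W \<in> span C. V \<bullet> W = f W"
    if "finite C" and "linear f" for C :: "'a set" and f :: "'a \<Rightarrow> real"
    using that
  proof (induction C arbitrary: f rule: finite_induct)
    case empty
    show ?case using linear_0[OF empty] by simp
  next
    case (insert a C)
    note f = insert.prems
    have "linear (\<lambda>W. a \<bullet> W)"
      by (simp add: linear_iff inner_add_right)
    from insert.IH[OF this]
    obtain Q where Q: "Q \<in> span C" "\<And>W. W \<in> span C \<Longrightarrow> Q \<bullet> W = a \<bullet> W" by blast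
    obtain P where P: "P \<in> span C" "\<And>W. W \<in> span C \<Longrightarrow> P \<bullet> W = f W"
      using insert.IH[OF f] by blast
    define n where "n = a - Q"
    have n: "n \<bullet> W = 0" if "W \<in> span C" for W
      using Q(2)[OF that] by (simp add: n_def inner_diff_left)
    have na: "n \<bullet> a = n \<bullet> n"
      using n[OF Q(1)] by (simp add: n_def inner_diff_right)
    define c where "c = (if n = 0 then 0 else (f a - P \<bullet> a) / (n \<bullet> n))"
    have sub: "span C \<subseteq> span (insert a C)" by (rule span_mono) blast
    have "n \<in> span (insert a C)"
      unfolding n_def using Q(1) sub by (intro span_diff) (auto intro: span_base)
    then have mem: "P + c *\<^sub>R n \<in> span (insert a C)"
      using P(1) sub by (intro span_add span_scale) auto
    have ata: "(P + c *\<^sub>R n) \<bullet> a = f a"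
    proof (cases "n = 0")
      case True
      then have "a \<in> span C" using Q(1) by (simp add: n_def)
      then show ?thesis using P(2) True by simp
    next
      case False
      then show ?thesis by (simp add: inner_add_left na c_def)
    qed
    have "(P + c *\<^sub>R n) \<bullet> W = f W" if W: "W \<in> span (insert a C)" for W
    proof -
      obtain k where k: "W - k *\<^sub>R a \<in> span C" using W by (auto simp: span_insert)
      have "(P + c *\<^sub>R n) \<bullet> (W - k *\<^sub>R a) = f (W - k *\<^sub>R a)"
        using P(2)[OF k] n[OF k] by (simp add: inner_add_left)
      then show ?thesis using ata
        by (simp add: inner_diff_right linear_diff[OF f] linear_scale[OF f])
    qed
    then show ?case using mem by blast
  qed
  obtain V where V: "\<And>W. V \<bullet> W = f W"
    using ex[OF B(1) f] B(2) by auto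
  show ?thesis
  proof (rule ex1I[of _ V])
    show "\<forall>W. V \<bullet> W = f W" using V by blast
  next
    fix U assume "\<forall>W. U \<bullet> W = f W"
    then show "U = V" using V vector_eq_rdot[of U V] by simp
  qed
qed

lemma inner_curvature_operator:
  fixes R :: "'a::real_inner form4"
  assumes "finite_dim TYPE('a)" and "algebraic_curvature_tensor R"
  shows "curvature_operator R X Y Z \<bullet> W = R X Y Z W"
proof -
  have "linear (\<lambda>W. R X Y Z W)"
    using assms(2) unfolding algebraic_curvature_tensor_def four_linear_def by blast
  then have "\<exists>!V. \<forall>W. V \<bullet> W = R X Y Z W"
    by (rule finite_dim_riesz[OF assms(1)])
  from theI'[OF this] show ?thesis
    unfolding curvature_operator_def by blast
qed

lemma inner_jacobi_operator:
  fixes R :: "'a::real_inner form4"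
  assumes "finite_dim TYPE('a)" and "algebraic_curvature_tensor R"
  shows "jacobi_operator R X Y \<bullet> W = R Y X X W"
  unfolding jacobi_operator_def by (rule inner_curvature_operator[OF assms])

end

theory Submission
  imports Defs
begin

text \<open>
  Fix \<open>X \<bottom> Y\<close>. For \<open>R = \<mu>\<^sub>0 R\<^sup>1 + \<Sum> \<mu>\<^sub>i R\<^bsup>J\<^sub>i\<^esup>\<close> both Jacobi operators are governed by one and
  the same endomorphism, \<open>A = \<Sum> \<mu>\<^sub>i g(J\<^sub>i Y, X) J\<^sub>i\<close>: exchanging \<open>X\<close> and \<open>Y\<close> only changes the
  sign of the coefficients, so that
  \<open>\<J>\<^sub>X Y = \<mu>\<^sub>0 |X|\<^sup>2 Y + 3 A X\<close> and \<open>\<J>\<^sub>Y X = \<mu>\<^sub>0 |Y|\<^sup>2 X - 3 A Y\<close>.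
  In the product of the two vectors, the term free of \<open>A\<close> is a multiple of
  \<open>g(X, Y) = 0\<close>; the terms linear in \<open>A\<close> are multiples of \<open>g(A X, X)\<close> and
  \<open>g(A Y, Y)\<close>, which vanish as \<open>A\<close> is skew-adjoint; and the term quadratic in \<open>A\<close> is a multiple
  of \<open>g(A X, A Y)\<close>. By the Hurwitz relations a linear combination of a Clifford family scales
  the scalar product by a constant (\<open>clifford_combination_conformal\<close>), hence \<open>A X \<bottom> A Y\<close>.
\<close>

lemma skew_adjoint_inner_self:
  assumes "skew_adjoint J"
  shows "J X \<bullet> X = 0"
proof -
  have "J X \<bullet> X = - (X \<bullet> J X)"
    using assms unfolding skew_adjoint_def by blast
  then show ?thesis by (simp add: inner_commute)
qed

text \<open>This is the form in which skew-adjointness turns the Hurwitz relations into statements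
  about the scalar product.\<close>

lemma clifford_family_inner:
  assumes J: "clifford_family m J" and i: "i \<in> {1..m}" and j: "j \<in> {1..m}"
  shows "J i X \<bullet> J j Y + J j X \<bullet> J i Y = (if i = j then 2 * (X \<bullet> Y) else 0)"
proof -
  have skew: "J k U \<bullet> V = - (U \<bullet> J k V)" if "k \<in> {1..m}" for k U V
    using J that unfolding clifford_family_def skew_adjoint_def by blast
  have hurwitz: "J i (J j Y) + J j (J i Y) = (- 2 * (if i = j then 1 else 0)) *\<^sub>R Y"
    using J i j unfolding clifford_family_def by blast
  have "J i X \<bullet> J j Y + J j X \<bullet> J i Y = - (X \<bullet> (J i (J j Y) + J j (J i Y)))"
    using skew[OF i] skew[OF j] by (simp add: inner_add_right)
  also have "\<dots> = (if i = j then 2 * (X \<bullet> Y) else 0)"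
    unfolding hurwitz by simp
  finally show ?thesis .
qed

text \<open>Symmetrising the double sum over pairs of indices produces the left-hand side of
  \<open>clifford_family_inner\<close>, so only the diagonal survives.\<close>

lemma clifford_combination_conformal:
  assumes J: "clifford_family m J"
  shows "(\<Sum>i=1..m. c i *\<^sub>R J i X) \<bullet> (\<Sum>i=1..m. c i *\<^sub>R J i Y) = (\<Sum>i=1..m. (c i)\<^sup>2) * (X \<bullet> Y)"
    (is "?P = _")
proof -
  have P': "?P = (\<Sum>i=1..m. \<Sum>j=1..m. c i * c j * (J j X \<bullet> J i Y))"
    by (simp add: inner_sum_left inner_sum_right sum_distrib_left mult.assoc)
  also have "\<dots> = (\<Sum>i=1..m. \<Sum>j=1..m. c i * c j * (J i X \<bullet> J j Y))"
    by (subst sum.swap) (simp only: mult.commute)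
  finally have P: "?P = (\<Sum>i=1..m. \<Sum>j=1..m. c i * c j * (J i X \<bullet> J j Y))" .
  have "2 * ?P = ?P + ?P" by (rule mult_2)
  also have "\<dots> = (\<Sum>i=1..m. \<Sum>j=1..m. c i * c j * (J i X \<bullet> J j Y))
      + (\<Sum>i=1..m. \<Sum>j=1..m. c i * c j * (J j X \<bullet> J i Y))"
    by (rule arg_cong2[OF P P'])
  also have "\<dots> = (\<Sum>i=1..m. \<Sum>j=1..m. c i * c j * (J i X \<bullet> J j Y + J j X \<bullet> J i Y))"
    by (simp only: sum.distrib distrib_left)
  also have "\<dots> = (\<Sum>i=1..m. \<Sum>j=1..m. if i = j then c i * c j * (2 * (X \<bullet> Y)) else 0)"
    by (intro sum.cong refl) (simp add: clifford_family_inner[OF J])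
  also have "\<dots> = 2 * ((\<Sum>i=1..m. (c i)\<^sup>2) * (X \<bullet> Y))"
    by (simp add: sum_distrib_left sum_distrib_right power2_eq_square mult_ac)
  finally show ?thesis by simp
qed

text \<open>The first summand of \<open>R\<^sup>J(Y,X,X,W)\<close> contributes one copy of \<open>g(J Y, X) g(J X, W)\<close>, the
  third two copies, and the second contains the factor \<open>g(J X, X)\<close>.\<close>

lemma curvature_of_jacobi:
  assumes "skew_adjoint J"
  shows "curvature_of J Y X X W = 3 * (J Y \<bullet> X) * (J X \<bullet> W)"
  by (simp add: curvature_of_def skew_adjoint_inner_self[OF assms])

lemma jacobi_operator_clifford:
  fixes R :: "'a::real_inner form4"
  assumes "finite_dim TYPE('a)" and "algebraic_curvature_tensor R"
    and J: "clifford_family m J"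
    and R: "\<And>X Y Z W. R X Y Z W =
      \<mu> 0 * curvature_one X Y Z W + (\<Sum>i=1..m. \<mu> i * curvature_of (J i) X Y Z W)"
    and orth: "X \<bullet> Y = 0"
  shows "jacobi_operator R X Y =
    (\<mu> 0 * (X \<bullet> X)) *\<^sub>R Y + 3 *\<^sub>R (\<Sum>i=1..m. (\<mu> i * (J i Y \<bullet> X)) *\<^sub>R J i X)"
    (is "_ = ?V")
proof -
  have skew: "skew_adjoint (J i)" if "i \<in> {1..m}" for i
    using J that unfolding clifford_family_def by blast
  have "jacobi_operator R X Y \<bullet> W = ?V \<bullet> W" for W
  proof -
    have "(\<Sum>i=1..m. \<mu> i * curvature_of (J i) Y X X W) =
        (\<Sum>i=1..m. 3 * (\<mu> i * (J i Y \<bullet> X) * (J i X \<bullet> W)))"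
      by (intro sum.cong refl) (simp add: curvature_of_jacobi[OF skew])
    then show ?thesis
      using orth
      by (simp add: inner_jacobi_operator[OF assms(1,2)] R curvature_one_def inner_commute[of Y X]
          inner_add_left inner_sum_left sum_distrib_left)
  qed
  then show ?thesis
    using vector_eq_rdot by blast
qed

theorem theorem2:
  fixes R :: "'a::real_inner \<Rightarrow> 'a \<Rightarrow> 'a \<Rightarrow> 'a \<Rightarrow> real"
  assumes "finite_dim TYPE('a)"
    and "algebraic_curvature_tensor R"
    and "clifford R"
  shows "jacobi_orthogonal R"
  unfolding jacobi_orthogonal_def
proof (intro allI impI)
  fix X Y :: 'a
  assume orth: "X \<bullet> Y = 0"
  obtain m J \<mu> where J: "clifford_family m J"
    and R: "\<And>X Y Z W. R X Y Z W =
      \<mu> 0 * curvature_one X Y Z W + (\<Sum>i=1..m. \<mu> i * curvature_of (J i) X Y Z W)"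
    using assms(3) unfolding clifford_def by blast
  have skew: "skew_adjoint (J i)" if "i \<in> {1..m}" for i
    using J that unfolding clifford_family_def by blast
  define A where "A U = (\<Sum>i=1..m. (\<mu> i * (J i Y \<bullet> X)) *\<^sub>R J i U)" for U
  have XY: "jacobi_operator R X Y = (\<mu> 0 * (X \<bullet> X)) *\<^sub>R Y + 3 *\<^sub>R A X"
    unfolding A_def by (rule jacobi_operator_clifford[OF assms(1,2) J R orth])
  have swap: "J i X \<bullet> Y = - (J i Y \<bullet> X)" if "i \<in> {1..m}" for i
    using skew[OF that] unfolding skew_adjoint_def by (metis inner_commute)
  have "(\<Sum>i=1..m. (\<mu> i * (J i X \<bullet> Y)) *\<^sub>R J i Y) = (\<Sum>i=1..m. - ((\<mu> i * (J i Y \<bullet> X)) *\<^sub>R J i Y))"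
    by (intro sum.cong refl) (simp add: swap)
  also have "\<dots> = - A Y"
    unfolding A_def by (rule sum_negf)
  finally have YX: "jacobi_operator R Y X = (\<mu> 0 * (Y \<bullet> Y)) *\<^sub>R X - 3 *\<^sub>R A Y"
    using jacobi_operator_clifford[OF assms(1,2) J R, of Y X] orth
    by (simp add: inner_commute)
  have self: "A U \<bullet> U = 0" for U
    unfolding A_def inner_sum_left
    by (intro sum.neutral ballI) (simp add: skew_adjoint_inner_self[OF skew])
  have "A X \<bullet> A Y = 0"
    unfolding A_def clifford_combination_conformal[OF J] orth by simp
  then show "jacobi_operator R X Y \<bullet> jacobi_operator R Y X = 0"
    using orth self[of X] self[of Y] unfolding XY YX
    by (simp add: inner_add_left inner_diff_right inner_commute[of Y X] inner_commute[of Y "A Y"])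
qed

end
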